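(* Let $G$ be a snake graph. There is a poset isomorphism $L(G)\cong J(\mathbb P(G))$ between the set of double lattice paths in $G$ and the lattice of lower order ideals of $\mathbb P(G)$.
   Context: A snake graph $G$ is a planar graph consisting of a sequence of square tiles $T_1,\dots,T_N$, each $T_{m+1}$ attached either to the right side or to the top side of $T_m$. A lattice path on $G$ is a path along edges of $G$ from the bottom-left corner of $T_1$ to the top-right corner of $T_N$ in which every step goes right or up. Lattice paths are ordered so that a path using both the bottom and the right edge of some tile is covered by the path obtained by replacing these two edges by the left and top edges of the same tile (the minimal path follows the bottom-right boundary). A double lattice path on $G$ is a multiset of edges that is the multiset union $p_1+p_2$ of two lattice paths $p_1,p_2$; $L(G)$ is the set of double lattice paths (as multisets). $L(G)$ is partially ordered by the reflexive-transitive closure of the following relation: $P<P'$ whenever $P=p_1+p_2$ and $P'=p_1'+p_2$ for lattice paths $p_1,p_1',p_2$ such that $p_1'$ covers $p_1$. (Equivalently, labelling each tile by the number, $0$, $1$ or $2$, of the two lattice paths passing above it, a cover relation increases one tile label by $1$.) $P(G)$ is the poset whose elements are the tiles $T_1,\dots,T_N$, with order generated by: $T_{m+1}<T_m$ if $T_{m+1}$ is to the right of $T_m$, and $T_{m+1}>T_m$ if $T_{m+1}$ is above $T_m$. $\mathbb P(G)=P(G)\times\{0<1\}$ is the product poset with the two-element chain. $J(Q)$ denotes the lattice of lower order ideals of a poset $Q$, ordered by inclusion. *)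

theory Defs
  imports Main "HOL-Library.Multiset"
begin

type_synonym point = "int \<times> int"

definition right_of :: "point \<Rightarrow> point" where
  "right_of v = (fst v + 1, snd v)"

definition above :: "point \<Rightarrow> point" where
  "above v = (fst v, snd v + 1)"

text \<open>A square tile is represented by its bottom-left corner, and an edge by the pair of its
  end points, the left or lower one first; every edge is thus a unit step to the right or up.\<close>

type_synonym tile = point
type_synonym edge = "point \<times> point"

definition bottom_edge :: "tile \<Rightarrow> edge" where
  "bottom_edge t = (t, right_of t)"

definition left_edge :: "tile \<Rightarrow> edge" where
  "left_edge t = (t, above t)"

definition right_edge :: "tile \<Rightarrow> edge" where
  "right_edge t = (right_of t, above (right_of t))"

definition top_edge :: "tile \<Rightarrow> edge" where
  "top_edge t = (above t, right_of (above t))"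

text \<open>A snake graph is the list of its tiles \<open>T\<^sub>1, \<dots>, T\<^sub>N\<close>, where \<open>N \<ge> 1\<close>.\<close>

definition snake_graph :: "tile list \<Rightarrow> bool" where
  "snake_graph G \<longleftrightarrow> G \<noteq> [] \<and> successively (\<lambda>s t. t = right_of s \<or> t = above s) G"

definition edges :: "tile list \<Rightarrow> edge set" where
  "edges G = (\<Union>t\<in>set G. {bottom_edge t, left_edge t, right_edge t, top_edge t})"

text \<open>A path is given by its list of vertices.\<close>

definition lattice_path :: "tile list \<Rightarrow> point list \<Rightarrow> bool" where
  "lattice_path G p \<longleftrightarrow> p \<noteq> [] \<and> hd p = hd G \<and> last p = right_of (above (last G)) \<and>
     successively (\<lambda>u v. (u, v) \<in> edges G \<and> (v = right_of u \<or> v = above u)) p"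

definition path_edges :: "point list \<Rightarrow> edge multiset" where
  "path_edges p = mset (zip p (tl p))"

definition covered_by :: "tile list \<Rightarrow> point list \<Rightarrow> point list \<Rightarrow> bool" where
  "covered_by G p p' \<longleftrightarrow> lattice_path G p \<and> lattice_path G p' \<and>
     (\<exists>t\<in>set G. bottom_edge t \<in># path_edges p \<and> right_edge t \<in># path_edges p \<and>
        path_edges p' =
          path_edges p - {#bottom_edge t, right_edge t#} + {#left_edge t, top_edge t#})"

definition double_lattice_paths :: "tile list \<Rightarrow> edge multiset set" where
  "double_lattice_paths G =
     {path_edges p1 + path_edges p2 | p1 p2. lattice_path G p1 \<and> lattice_path G p2}"

definition double_lattice_path_step :: "tile list \<Rightarrow> edge multiset rel" where
  "double_lattice_path_step G =
     {(path_edges p1 + path_edges p2, path_edges p1' + path_edges p2) | p1 p1' p2.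
        lattice_path G p1 \<and> lattice_path G p1' \<and> lattice_path G p2 \<and> covered_by G p1 p1'}"

text \<open>Here and below, \<open>Restr\<close> is needed because \<open>rtrancl\<close> is reflexive on the whole type.\<close>

definition double_lattice_path_order :: "tile list \<Rightarrow> edge multiset rel" where
  "double_lattice_path_order G =
     Restr ((double_lattice_path_step G)\<^sup>*) (double_lattice_paths G)"

text \<open>The poset \<open>P(G)\<close> has carrier \<open>set G\<close>; a pair \<open>(s, t)\<close> in the relation means \<open>s \<le> t\<close>.\<close>

definition tile_gen :: "tile list \<Rightarrow> tile rel" where
  "tile_gen G =
     {(G ! Suc m, G ! m) | m. Suc m < length G \<and> G ! Suc m = right_of (G ! m)} \<union>
     {(G ! m, G ! Suc m) | m. Suc m < length G \<and> G ! Suc m = above (G ! m)}"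

definition tile_order :: "tile list \<Rightarrow> tile rel" where
  "tile_order G = Restr ((tile_gen G)\<^sup>*) (set G)"

definition prod_order :: "'a rel \<Rightarrow> 'b rel \<Rightarrow> ('a \<times> 'b) rel" where
  "prod_order r s = {((a, b), (a', b')). (a, a') \<in> r \<and> (b, b') \<in> s}"

definition PP_carrier :: "tile list \<Rightarrow> (tile \<times> nat) set" where
  "PP_carrier G = set G \<times> {0, 1}"

definition PP_order :: "tile list \<Rightarrow> (tile \<times> nat) rel" where
  "PP_order G = prod_order (tile_order G) (relation_of (\<le>) {0, 1})"

definition order_ideals :: "'a set \<Rightarrow> 'a rel \<Rightarrow> 'a set set" where
  "order_ideals A r = {I. I \<subseteq> A \<and> (\<forall>x\<in>I. \<forall>y\<in>A. (y, x) \<in> r \<longrightarrow> y \<in> I)}"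

definition poset_iso :: "'a set \<Rightarrow> 'a rel \<Rightarrow> 'b set \<Rightarrow> 'b rel \<Rightarrow> ('a \<Rightarrow> 'b) \<Rightarrow> bool" where
  "poset_iso A r B s f \<longleftrightarrow> partial_order_on A r \<and> partial_order_on B s \<and> bij_betw f A B \<and>
     (\<forall>x\<in>A. \<forall>y\<in>A. (x, y) \<in> r \<longleftrightarrow> (f x, f y) \<in> s)"

lemma partial_order_on_tile_order: "partial_order_on (set G) (tile_order G)"
proof -
  define h :: "tile \<Rightarrow> int" where "h = (\<lambda>t. snd t - fst t)"
  have gen: "h s < h t" if "(s, t) \<in> tile_gen G" for s t
    using that by (auto simp: tile_gen_def h_def right_of_def above_def)
  have le: "s = t \<or> h s < h t" if "(s, t) \<in> (tile_gen G)\<^sup>*" for s t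
    using that by (induction rule: rtrancl_induct) (auto dest: gen)
  have "antisym (tile_order G)"
  proof (rule antisymI)
    fix s t assume "(s, t) \<in> tile_order G" "(t, s) \<in> tile_order G"
    then show "s = t"
      using le[of s t] le[of t s] by (auto simp: tile_order_def)
  qed
  moreover have "trans (tile_order G)"
    unfolding tile_order_def by (intro trans_Restr trans_rtrancl)
  moreover have "refl_on (set G) (tile_order G)" "tile_order G \<subseteq> set G \<times> set G"
    by (auto simp: refl_on_def tile_order_def)
  ultimately show ?thesis
    by (simp add: partial_order_on_def preorder_on_def)
qed

lemma partial_order_on_PP_order: "partial_order_on (PP_carrier G) (PP_order G)"
proof -
  have *: "refl_on (set G) (tile_order G)" "tile_order G \<subseteq> set G \<times> set G"
    "trans (tile_order G)" "antisym (tile_order G)"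
    using partial_order_on_tile_order[of G]
    by (simp_all add: partial_order_on_def preorder_on_def)
  have "refl_on (PP_carrier G) (PP_order G)" "PP_order G \<subseteq> PP_carrier G \<times> PP_carrier G"
    using *(1,2)
    by (auto simp: refl_on_def PP_order_def PP_carrier_def prod_order_def relation_of_def)
  moreover have "trans (PP_order G)"
    by (rule transI)
      (auto simp: PP_order_def prod_order_def relation_of_def intro: transD[OF *(3)])
  moreover have "antisym (PP_order G)"
    by (rule antisymI)
      (auto simp: PP_order_def prod_order_def relation_of_def dest: antisymD[OF *(4)])
  ultimately show ?thesis
    by (simp add: partial_order_on_def preorder_on_def)
qed

end

theory Submission
  imports Defs
begin

text \<open>
  Measure the level of a vertex by the sum of its coordinates.  Each step of a lattice path raises
  the level by one, and the tiles of a snake graph lie on consecutive levels.  On the level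
  following that of a tile \<open>t\<close> the graph has exactly the two vertices \<open>right_of t\<close> and \<open>above t\<close>, so a lattice
  path is determined by the set \<open>S\<close> of tiles \<open>t\<close> for which it visits \<open>above t\<close>, that is, which it
  passes above.  If the next tile is to the right of \<open>t\<close>, a path that visits \<open>above t\<close> can only
  continue above the next tile; if the next tile is above \<open>t\<close>, a path above the next tile must
  come from \<open>above t\<close>.  These are exactly the conditions for \<open>S\<close> to be an ideal of \<open>P(G)\<close>:
  lattice paths are the ideals of \<open>P(G)\<close> (\<open>lattice_path_tile_path\<close>,
  \<open>lattice_path_imp_tile_path\<close>).

  Two paths with ideals \<open>S\<close> and \<open>T\<close> can be uncrossed: together they use the same multiset of edges
  as the paths with ideals \<open>S \<union> T\<close> and \<open>S \<inter> T\<close> (\<open>path_edges_sup_inf\<close>).  Hence every double lattice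
  path comes from a nested pair of ideals \<open>S\<^sub>1 \<subseteq> S\<^sub>0\<close>, and such a pair is the same as the
  ideal \<open>S\<^sub>0 \<times> {0} \<union> S\<^sub>1 \<times> {1}\<close> of \<open>P(G) \<times> {0 < 1}\<close> (\<open>PP_ideals_iff\<close>).  The pair
  can be read off the edge multiset, because the number of edges that end in \<open>above t\<close> is the
  number of paths passing above \<open>t\<close> (\<open>count_heads_tile_path\<close>).  This yields the bijection.

  For the orders, a covering move only replaces a visit to \<open>right_of t\<close> by a visit to \<open>above t\<close>,
  so the ideal can only grow (\<open>step_imp_ideal_of_subset\<close>).  Conversely, between two nested ideals
  of a finite poset one can pass by adding one element at a time (\<open>ex_insert_order_ideal\<close>), and
  adding one element to an ideal of \<open>P(G) \<times> {0 < 1}\<close> is a covering move of one of the two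
  paths (\<open>covered_by_insert\<close>, \<open>paths_of_insert_step\<close>).
\<close>

section \<open>Levels\<close>

definition level :: "point \<Rightarrow> int" where
  "level v = fst v + snd v"

lemma level_step [simp]: "level (right_of v) = level v + 1" "level (above v) = level v + 1"
  by (simp_all add: level_def right_of_def above_def)

lemma right_of_neq_above [simp]: "right_of v \<noteq> above v" "above v \<noteq> right_of v"
  by (simp_all add: right_of_def above_def)

lemma right_of_above: "right_of (above v) = above (right_of v)"
  by (simp add: right_of_def above_def)

section \<open>Ideals of finite posets\<close>

text \<open>A minimal element of \<open>J - I\<close> can be added.  It is chosen here as an element with the fewest
  elements of the poset below it.\<close>

lemma ex_insert_order_ideal:
  assumes po: "partial_order_on A r" and fin: "finite A"
    and I: "I \<in> order_ideals A r" and J: "J \<in> order_ideals A r" and "I \<subset> J"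
  obtains x where "x \<in> J - I" "insert x I \<in> order_ideals A r"
proof -
  have tr: "trans r" and anti: "antisym r" and ref: "refl_on A r"
    using po by (auto simp: partial_order_on_def preorder_on_def)
  have JA: "J \<subseteq> A"
    using J by (auto simp: order_ideals_def)
  define d where "d x = card {y \<in> A. (y, x) \<in> r}" for x
  obtain x where x: "x \<in> J - I" and least: "\<And>y. y \<in> J - I \<Longrightarrow> d x \<le> d y"
    using \<open>I \<subset> J\<close> ex_has_least_nat[of "\<lambda>x. x \<in> J - I" _ d] by blast
  have below: "y \<in> insert x I" if "y \<in> A" "(y, x) \<in> r" for y
  proof (rule ccontr)
    assume y: "y \<notin> insert x I"
    then have "y \<in> J - I"
      using that x J by (auto simp: order_ideals_def)
    have "{z \<in> A. (z, y) \<in> r} \<subset> {z \<in> A. (z, x) \<in> r}"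
    proof
      show "{z \<in> A. (z, y) \<in> r} \<subseteq> {z \<in> A. (z, x) \<in> r}"
        using transD[OF tr _ that(2)] by blast
      have "x \<in> {z \<in> A. (z, x) \<in> r}" "x \<notin> {z \<in> A. (z, y) \<in> r}"
        using x JA refl_onD[OF ref] antisymD[OF anti _ that(2)] y by auto
      then show "{z \<in> A. (z, y) \<in> r} \<noteq> {z \<in> A. (z, x) \<in> r}"
        by blast
    qed
    then have "d y < d x"
      unfolding d_def using fin by (intro psubset_card_mono) auto
    then show False
      using least[OF \<open>y \<in> J - I\<close>] by simp
  qed
  have "insert x I \<in> order_ideals A r"
    using I x JA below unfolding order_ideals_def by blast
  then show ?thesis
    using x that by blast
qed

text \<open>Closure under the generators suffices, so ideals only have to be tested on consecutive tiles.\<close>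

lemma tile_ideals_iff:
  "S \<in> order_ideals (set G) (tile_order G) \<longleftrightarrow>
     S \<subseteq> set G \<and> (\<forall>(s, t)\<in>tile_gen G. t \<in> S \<longrightarrow> s \<in> S)" (is "?L \<longleftrightarrow> ?R")
proof
  have "tile_gen G \<subseteq> tile_order G"
    unfolding tile_order_def by (auto simp: tile_gen_def) (metis Suc_lessD nth_mem)+
  then show "?L \<Longrightarrow> ?R"
    by (fastforce simp: order_ideals_def tile_order_def)
next
  assume R: ?R
  have "t \<in> S \<longrightarrow> s \<in> S" if "(s, t) \<in> (tile_gen G)\<^sup>*" for s t
    using that by (induction rule: converse_rtrancl_induct) (use R in auto)
  then show ?L
    using R by (auto simp: order_ideals_def tile_order_def)
qed

text \<open>An ideal of the product with a two-element chain is a nested pair of ideals, its two slices;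
  the upper slice is the smaller one.\<close>

lemma PP_ideals_iff:
  "I \<in> order_ideals (PP_carrier G) (PP_order G) \<longleftrightarrow>
     I \<subseteq> PP_carrier G \<and>
     {t. (t, 0) \<in> I} \<in> order_ideals (set G) (tile_order G) \<and>
     {t. (t, 1) \<in> I} \<in> order_ideals (set G) (tile_order G) \<and>
     {t. (t, 1) \<in> I} \<subseteq> {t. (t, 0) \<in> I}" (is "?L \<longleftrightarrow> ?R")
proof
  assume L: ?L
  then have sub: "I \<subseteq> PP_carrier G"
    by (simp add: order_ideals_def)
  have closed: "(s, i) \<in> I" if "(t, j) \<in> I" "(s, t) \<in> tile_order G" "i \<le> j" for s t i j
  proof -
    have "i \<in> {0, 1}" "j \<in> {0, 1}"
      using sub that by (auto simp: PP_carrier_def)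
    moreover from this have "(s, i) \<in> PP_carrier G"
      using that(2) by (auto simp: tile_order_def PP_carrier_def)
    ultimately show ?thesis
      using L that unfolding order_ideals_def
      by (auto simp: PP_order_def prod_order_def relation_of_def)
  qed
  have "(t, t) \<in> tile_order G" if "(t, j) \<in> I" for t j
    using sub that by (auto simp: tile_order_def PP_carrier_def)
  then show ?R
    using sub closed[of _ 0 _ 0] closed[of _ 1 _ 1] closed[of _ 1 _ 0]
    unfolding order_ideals_def PP_carrier_def by auto
next
  assume R: ?R
  have "(s, i) \<in> I"
    if "(t, j) \<in> I" "(s, t) \<in> tile_order G" "i \<in> {0, 1}" "j \<in> {0, 1}" "i \<le> j" for s t i j
  proof -
    have "s \<in> set G"
      using that(2) by (simp add: tile_order_def)
    moreover have "{t. (t, j) \<in> I} \<in> order_ideals (set G) (tile_order G)"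
      using R that(4) by auto
    ultimately have "(s, j) \<in> I"
      using that(1,2) unfolding order_ideals_def by blast
    then show ?thesis
      using that R by auto
  qed
  then show ?L
    using R unfolding order_ideals_def PP_carrier_def PP_order_def prod_order_def relation_of_def
    by auto
qed

section \<open>Lattice paths as ideals of tiles\<close>

text \<open>The \<open>k\<close>-th vertex of the path that passes above exactly the tiles in the ideal \<open>S\<close>.  Vertex \<open>i + 1\<close>
  lies one level above tile \<open>i\<close>, with tiles counted from 0.\<close>

definition path_vertex :: "tile list \<Rightarrow> tile set \<Rightarrow> nat \<Rightarrow> point" where
  "path_vertex G S k =
     (case k of
        0 \<Rightarrow> hd G
      | Suc i \<Rightarrow>
          if i < length G then if G ! i \<in> S then above (G ! i) else right_of (G ! i)
          else right_of (above (last G)))"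

definition tile_path :: "tile list \<Rightarrow> tile set \<Rightarrow> point list" where
  "tile_path G S = map (path_vertex G S) [0..<length G + 2]"

lemma path_vertex_simps [simp]:
  "path_vertex G S 0 = hd G"
  "i < length G \<Longrightarrow>
     path_vertex G S (Suc i) = (if G ! i \<in> S then above (G ! i) else right_of (G ! i))"
  "path_vertex G S (Suc (length G)) = right_of (above (last G))"
  by (simp_all add: path_vertex_def)

lemma path_edges_conv_nth:
  "path_edges p = image_mset (\<lambda>k. (p ! k, p ! Suc k)) (mset_set {..<length p - 1})"
proof -
  have "zip p (tl p) = map (\<lambda>k. (p ! k, p ! Suc k)) [0..<length p - 1]"
    by (rule nth_equalityI) (auto simp: nth_tl)
  then have "path_edges p = image_mset (\<lambda>k. (p ! k, p ! Suc k)) (mset [0..<length p - 1])"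
    by (simp only: path_edges_def mset_map)
  then show ?thesis
    by (simp only: mset_upt atLeast0LessThan)
qed

lemma path_edges_tile_path:
  "path_edges (tile_path G S) =
     image_mset (\<lambda>k. (path_vertex G S k, path_vertex G S (Suc k))) (mset_set {..length G})"
  unfolding path_edges_conv_nth tile_path_def
  by (simp add: lessThan_Suc_atMost del: upt_Suc) (rule image_mset_cong, simp del: upt_Suc)

context
  fixes G :: "tile list"
  assumes snake: "snake_graph G"
begin

lemma snake_nonempty: "G \<noteq> []" "0 < length G"
  using snake by (auto simp: snake_graph_def)

lemma snake_step:
  assumes "Suc i < length G"
  shows "G ! Suc i = right_of (G ! i) \<or> G ! Suc i = above (G ! i)"
  using snake assms by (auto simp: snake_graph_def successively_conv_nth)

lemma level_tile: "i < length G \<Longrightarrow> level (G ! i) = level (hd G) + int i"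
proof (induction i)
  case 0
  then show ?case
    using snake_nonempty by (simp add: hd_conv_nth)
next
  case (Suc i)
  then show ?case
    using snake_step[of i] by auto
qed

lemma level_last: "level (last G) = level (hd G) + int (length G) - 1"
  using level_tile[of "length G - 1"] snake_nonempty by (simp add: last_conv_nth of_nat_diff)

lemma level_path_vertex: "k \<le> Suc (length G) \<Longrightarrow> level (path_vertex G S k) = level (hd G) + int k"
  by (cases k; cases "k = Suc (length G)") (auto simp: level_tile level_last)

lemma last_tile: "Suc i = length G \<Longrightarrow> last G = G ! i"
  by (metis diff_Suc_1 last_conv_nth snake_nonempty(1))

lemma tile_eqI: "s \<in> set G \<Longrightarrow> t \<in> set G \<Longrightarrow> level s = level t \<Longrightarrow> s = t"
  by (auto simp: in_set_conv_nth level_tile)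

lemma tile_ideal_right:
  assumes "S \<in> order_ideals (set G) (tile_order G)" "Suc i < length G"
    "G ! Suc i = right_of (G ! i)" "G ! i \<in> S"
  shows "G ! Suc i \<in> S"
  using assms unfolding tile_ideals_iff tile_gen_def by blast

lemma tile_ideal_above:
  assumes "S \<in> order_ideals (set G) (tile_order G)" "Suc i < length G"
    "G ! Suc i = above (G ! i)" "G ! Suc i \<in> S"
  shows "G ! i \<in> S"
  using assms unfolding tile_ideals_iff tile_gen_def by blast

lemma edges_nth:
  assumes "i < length G"
  shows "(G ! i, right_of (G ! i)) \<in> edges G" "(G ! i, above (G ! i)) \<in> edges G"
    "(right_of (G ! i), above (right_of (G ! i))) \<in> edges G"
    "(above (G ! i), above (right_of (G ! i))) \<in> edges G"
proof -
  have "{bottom_edge t, left_edge t, right_edge t, top_edge t} \<subseteq> edges G" if "t \<in> set G" for t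
    using that by (auto simp: edges_def)
  from this[of "G ! i"] assms
  show "(G ! i, right_of (G ! i)) \<in> edges G" "(G ! i, above (G ! i)) \<in> edges G"
    "(right_of (G ! i), above (right_of (G ! i))) \<in> edges G"
    "(above (G ! i), above (right_of (G ! i))) \<in> edges G"
    by (simp_all add: bottom_edge_def left_edge_def right_edge_def top_edge_def right_of_above)
qed

text \<open>Of the four pairs of vertices on the levels following two consecutive tiles, just one is not
  joined by an edge, and it is the pair that the ideal property at these tiles excludes.\<close>

lemma lattice_path_tile_path:
  assumes S: "S \<in> order_ideals (set G) (tile_order G)"
  shows "lattice_path G (tile_path G S)"
proof -
  have step: "(u, v) \<in> edges G \<and> (v = right_of u \<or> v = above u)"
    if "k \<le> length G" "u = path_vertex G S k" "v = path_vertex G S (Suc k)" for k u v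
  proof (cases k)
    case 0
    then show ?thesis
      using that snake_nonempty edges_nth[of 0] by (auto simp: hd_conv_nth)
  next
    case (Suc i)
    show ?thesis
    proof (cases "k = length G")
      case True
      then have "last G = G ! i" and i: "i < length G"
        using Suc by (simp_all add: last_tile)
      moreover have "u = (if G ! i \<in> S then above (G ! i) else right_of (G ! i))"
        using that(2) Suc i by simp
      moreover have "v = right_of (above (last G))"
        using that(3) True by simp
      ultimately show ?thesis
        using edges_nth[OF i] by (simp add: right_of_above)
    next
      case False
      then have less: "Suc i < length G"
        using that Suc by simp
      have u: "u = (if G ! i \<in> S then above (G ! i) else right_of (G ! i))"
        and v: "v = (if G ! Suc i \<in> S then above (G ! Suc i) else right_of (G ! Suc i))"
        using that Suc less by simp_all
      have edges: "(G ! Suc i, right_of (G ! Suc i)) \<in> edges G" "(G ! Suc i, above (G ! Suc i)) \<in> edges G"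
        "(right_of (G ! i), above (right_of (G ! i))) \<in> edges G"
        "(above (G ! i), above (right_of (G ! i))) \<in> edges G"
        using edges_nth[of i] edges_nth[OF less] less by simp_all
      show ?thesis
        using snake_step[OF less]
      proof
        assume right: "G ! Suc i = right_of (G ! i)"
        show ?thesis
          using tile_ideal_right[OF S less right] edges unfolding u v right
          by (auto simp: right_of_above)
      next
        assume up: "G ! Suc i = above (G ! i)"
        show ?thesis
          using tile_ideal_above[OF S less up] edges unfolding u v up
          by (auto simp: right_of_above)
      qed
    qed
  qed
  have "hd (tile_path G S) = hd G" "last (tile_path G S) = right_of (above (last G))"
    by (simp_all add: tile_path_def hd_map last_map del: upt_Suc)
  moreover have "tile_path G S \<noteq> []"
    by (simp add: tile_path_def)
  ultimately show ?thesis
    unfolding lattice_path_def successively_conv_nth using step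
    by (auto simp: tile_path_def simp del: upt_Suc)
qed

text \<open>The top-right corner of a tile that is not the last one is also a top-left or bottom-right
  corner of the next tile, so it needs no case of its own.\<close>

lemma edge_head_cases:
  assumes "(u, v) \<in> edges G"
  obtains i where "i < length G" "v = right_of (G ! i) \<or> v = above (G ! i)"
  | "v = right_of (above (last G))"
proof -
  obtain i where i: "i < length G"
    and v: "v = right_of (G ! i) \<or> v = above (G ! i) \<or> v = above (right_of (G ! i))"
    using assms unfolding edges_def bottom_edge_def left_edge_def right_edge_def top_edge_def
    by (auto simp: in_set_conv_nth right_of_above)
  show ?thesis
  proof (cases "v = above (right_of (G ! i))")
    case False
    then show ?thesis
      using i v that by blast
  next
    case True
    show ?thesis
    proof (cases "Suc i < length G")
      case less: True
      then show ?thesis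
        using snake_step[OF less] that(1)[OF less] True by (auto simp: right_of_above)
    next
      case False
      then have "last G = G ! i"
        using i by (intro last_tile) simp
      then show ?thesis
        using that(2) True by (simp add: right_of_above)
    qed
  qed
qed

text \<open>Levels pin down the length of the path and leave two choices for each inner vertex; that the
  steps go only right or up then forces the ideal property.\<close>

lemma lattice_path_imp_tile_path:
  assumes p: "lattice_path G p"
  obtains S where "S \<in> order_ideals (set G) (tile_order G)" "p = tile_path G S"
proof -
  have nonempty: "p \<noteq> []" and hd: "hd p = hd G" and last: "last p = right_of (above (last G))"
    using p by (auto simp: lattice_path_def)
  have edge: "(p ! k, p ! Suc k) \<in> edges G"
    and step: "p ! Suc k = right_of (p ! k) \<or> p ! Suc k = above (p ! k)"
    if "Suc k < length p" for k
    using p that unfolding lattice_path_def successively_conv_nth by auto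
  have level: "k < length p \<Longrightarrow> level (p ! k) = level (hd G) + int k" for k
  proof (induction k)
    case 0
    then show ?case
      using nonempty hd by (simp add: hd_conv_nth)
  next
    case (Suc k)
    then show ?case
      using step[of k] by auto
  qed
  have len: "length p = length G + 2"
  proof -
    have "level (last p) = level (hd G) + int (length p - 1)"
      using level[of "length p - 1"] nonempty by (simp add: last_conv_nth)
    then have "length p - 1 = length G + 1"
      using last level_last by simp
    then show ?thesis
      by simp
  qed
  have vertex: "p ! Suc i = right_of (G ! i) \<or> p ! Suc i = above (G ! i)" if "i < length G" for i
  proof -
    have "level (p ! Suc i) = level (hd G) + int (Suc i)"
      using level that len by simp
    moreover have "(p ! i, p ! Suc i) \<in> edges G"
      using edge that len by simp
    ultimately show ?thesis
      using that by (elim edge_head_cases) (auto simp: level_tile level_last)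
  qed
  define S where "S = {t \<in> set G. above t \<in> set p}"
  have S_iff: "G ! i \<in> S \<longleftrightarrow> p ! Suc i = above (G ! i)" if i: "i < length G" for i
  proof
    assume "G ! i \<in> S"
    then obtain k where k: "k < length p" "p ! k = above (G ! i)"
      by (auto simp: S_def in_set_conv_nth)
    then have "k = Suc i"
      using level[of k] level_tile[OF i] by simp
    then show "p ! Suc i = above (G ! i)"
      using k by simp
  next
    assume "p ! Suc i = above (G ! i)"
    then show "G ! i \<in> S"
      using i len nth_mem[of "Suc i" p] by (auto simp: S_def)
  qed
  have "p = tile_path G S"
  proof (rule nth_equalityI)
    fix k assume k: "k < length p"
    have "p ! k = path_vertex G S k"
    proof (cases k)
      case 0
      then show ?thesis
        using hd nonempty by (simp add: hd_conv_nth)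
    next
      case (Suc i)
      show ?thesis
      proof (cases "i < length G")
        case True
        then show ?thesis
          using vertex[of i] S_iff[of i] Suc by auto
      next
        case False
        then have "i = length G"
          using k len Suc by simp
        then show ?thesis
          using last len nonempty Suc by (simp add: last_conv_nth)
      qed
    qed
    then show "p ! k = tile_path G S ! k"
      using k len by (simp add: tile_path_def del: upt_Suc)
  qed (simp add: len tile_path_def)
  moreover have "S \<in> order_ideals (set G) (tile_order G)"
  proof -
    have right: "G ! Suc i \<in> S"
      if "Suc i < length G" "G ! Suc i = right_of (G ! i)" "G ! i \<in> S" for i
    proof (rule ccontr)
      assume "G ! Suc i \<notin> S"
      then have "p ! Suc (Suc i) = right_of (right_of (G ! i))"
        using vertex[of "Suc i"] S_iff[of "Suc i"] that(1,2) by simp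
      moreover have "p ! Suc i = above (G ! i)"
        using S_iff[of i] that by simp
      ultimately show False
        using step[of "Suc i"] len that(1) by (simp add: right_of_def above_def)
    qed
    have up: "G ! i \<in> S"
      if "Suc i < length G" "G ! Suc i = above (G ! i)" "G ! Suc i \<in> S" for i
    proof (rule ccontr)
      assume "G ! i \<notin> S"
      then have "p ! Suc i = right_of (G ! i)"
        using vertex[of i] S_iff[of i] that(1) by simp
      moreover have "p ! Suc (Suc i) = above (above (G ! i))"
        using S_iff[of "Suc i"] that by simp
      ultimately show False
        using step[of "Suc i"] len that(1) by (simp add: right_of_def above_def)
    qed
    show ?thesis
      unfolding tile_ideals_iff using right up by (auto simp: tile_gen_def S_def)
  qed
  ultimately show ?thesis
    using that by blast
qed

section \<open>Edge multisets\<close>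

text \<open>Only the step from the level of \<open>t\<close> to the next one can end in \<open>above t\<close>.  So the tiles below
  a path are visible in its edge multiset, and this count is additive over sums of paths.\<close>

lemma count_heads_tile_path:
  assumes "t \<in> set G"
  shows "count (image_mset snd (path_edges (tile_path G S))) (above t) = (if t \<in> S then 1 else 0)"
proof -
  obtain i where i: "i < length G" "t = G ! i"
    using assms by (auto simp: in_set_conv_nth)
  have unique: "k = i" if "path_vertex G S (Suc k) = above (G ! i)" "k \<le> length G" for k
    using level_path_vertex[of "Suc k" S] level_tile[OF i(1)] that by simp
  have "{k. k \<le> length G \<and> path_vertex G S (Suc k) = above t} =
      {k. k = i \<and> path_vertex G S (Suc i) = above t}"
    using unique i by (intro Collect_cong) (metis less_imp_le)
  also have "\<dots> = (if t \<in> S then {i} else {})"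
    using i by auto
  finally have "{k. k \<le> length G \<and> path_vertex G S (Suc k) = above t} = (if t \<in> S then {i} else {})" .
  moreover have "count (image_mset snd (path_edges (tile_path G S))) (above t) =
      (\<Sum>k\<in>{k. k \<le> length G \<and> path_vertex G S (Suc k) = above t}. count (mset_set {..length G}) k)"
    by (simp add: path_edges_tile_path image_mset.compositionality o_def count_image_mset'
        eq_commute[of "above t"])
  ultimately show ?thesis
    using i by auto
qed

text \<open>Uncrossing two paths.  The two edges leaving a given level agree on both sides: for consecutive
  tiles the ideal property allows only three of the four membership patterns, and these three form
  a chain, so the union and the intersection of two patterns are the two patterns themselves.\<close>

lemma path_edges_sup_inf:
  assumes S: "S \<in> order_ideals (set G) (tile_order G)"
    and T: "T \<in> order_ideals (set G) (tile_order G)"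
  shows "path_edges (tile_path G S) + path_edges (tile_path G T) =
    path_edges (tile_path G (S \<union> T)) + path_edges (tile_path G (S \<inter> T))"
proof -
  define e where "e U k = (path_vertex G U k, path_vertex G U (Suc k))" for U k
  have eq: "{#e S k#} + {#e T k#} = {#e (S \<union> T) k#} + {#e (S \<inter> T) k#}" if "k \<le> length G" for k
  proof (cases k)
    case 0
    then show ?thesis
      using snake_nonempty by (auto simp: e_def)
  next
    case (Suc i)
    show ?thesis
    proof (cases "k = length G")
      case True
      then have "path_vertex G U (Suc k) = right_of (above (last G))" for U
        by simp
      moreover have "path_vertex G U k = (if G ! i \<in> U then above (G ! i) else right_of (G ! i))" for U
        using Suc that by simp
      ultimately show ?thesis
        by (auto simp: e_def)
    next
      case False
      then have less: "Suc i < length G"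
        using that Suc by simp
      show ?thesis
        using snake_step[OF less] tile_ideal_right[OF S less] tile_ideal_right[OF T less]
          tile_ideal_above[OF S less] tile_ideal_above[OF T less] less Suc
        by (auto simp: e_def)
    qed
  qed
  have sum: "path_edges (tile_path G U) = (\<Sum>k\<le>length G. {#e U k#})" for U
    by (simp add: path_edges_tile_path e_def sum_unfold_sum_mset)
  show ?thesis
    unfolding sum sum.distrib[symmetric] using eq by (intro sum.cong) auto
qed

text \<open>That \<open>t\<close> can be added to \<open>S\<close> fixes the membership of its two neighbours so that both paths
  run through the bottom-left and the top-right corner of \<open>t\<close>.  They differ only in between, one
  taking the bottom and right edge, the other the left and top edge.\<close>

lemma covered_by_insert:
  assumes S: "S \<in> order_ideals (set G) (tile_order G)"
    and T: "insert t S \<in> order_ideals (set G) (tile_order G)"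
    and t: "t \<notin> S"
  shows "covered_by G (tile_path G S) (tile_path G (insert t S))"
proof -
  have "t \<in> set G"
    using T by (auto simp: order_ideals_def)
  then obtain k where k: "k < length G" "t = G ! k"
    by (auto simp: in_set_conv_nth)
  have other: "G ! i \<in> insert t S \<longleftrightarrow> G ! i \<in> S" if "i < length G" "i \<noteq> k" for i
    using that k level_tile[of i] level_tile[of k] by auto
  have lower: "path_vertex G U k = t" if U: "U = S \<or> U = insert t S" for U
  proof (cases k)
    case 0
    then show ?thesis
      using k by (simp add: hd_conv_nth snake_nonempty)
  next
    case (Suc i)
    then have less: "Suc i < length G"
      using k by simp
    have t_eq: "t = G ! Suc i" and i_neq: "i \<noteq> k"
      using k Suc by simp_all
    have "G ! i \<in> U \<longleftrightarrow> G ! Suc i = above (G ! i)"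
    proof (cases "G ! Suc i = above (G ! i)")
      case True
      then have "G ! i \<in> insert t S"
        using tile_ideal_above[OF T less] t_eq by blast
      then show ?thesis
        using True other[of i] less i_neq U by auto
    next
      case False
      then have "G ! i \<notin> S"
        using snake_step[OF less] tile_ideal_right[OF S less] t t_eq by blast
      then show ?thesis
        using False other[of i] less i_neq U by auto
    qed
    then show ?thesis
      using snake_step[OF less] less unfolding Suc t_eq by auto
  qed
  have upper: "path_vertex G U (Suc (Suc k)) = above (right_of t)" if U: "U = S \<or> U = insert t S" for U
  proof (cases "Suc k = length G")
    case True
    then have "last G = t"
      using k by (simp add: last_tile)
    then show ?thesis
      using True by (simp add: right_of_above)
  next
    case False
    then have less: "Suc k < length G"
      using k by simp
    have "G ! Suc k \<in> U \<longleftrightarrow> G ! Suc k = right_of t"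
    proof (cases "G ! Suc k = right_of t")
      case True
      then have "G ! Suc k \<in> insert t S"
        using tile_ideal_right[OF T less] k by blast
      then show ?thesis
        using True other[OF less] U by auto
    next
      case False
      then have "G ! Suc k \<notin> S"
        using snake_step[OF less] tile_ideal_above[OF S less] t k by blast
      then show ?thesis
        using False other[OF less] U by auto
    qed
    then show ?thesis
      using snake_step[OF less] less unfolding k(2) by (auto simp: right_of_above)
  qed
  have agree: "path_vertex G (insert t S) i = path_vertex G S i" if "i \<noteq> Suc k" for i
    using that other by (cases i) (auto simp: path_vertex_def)
  define e where "e = (\<lambda>U i. (path_vertex G U i, path_vertex G U (Suc i)))"
  define B where "B = {..length G} - {k, Suc k}"
  have "{..length G} = insert k (insert (Suc k) B)" "k \<notin> insert (Suc k) B" "Suc k \<notin> B" "finite B"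
    using k by (auto simp: B_def)
  then have split: "path_edges (tile_path G U) = {#e U k, e U (Suc k)#} + image_mset (e U) (mset_set B)"
    for U
    by (simp add: path_edges_tile_path e_def)
  have rest: "image_mset (e (insert t S)) (mset_set B) = image_mset (e S) (mset_set B)"
    by (rule image_mset_cong) (auto simp: e_def B_def agree)
  have "e S k = bottom_edge t" "e S (Suc k) = right_edge t"
    "e (insert t S) k = left_edge t" "e (insert t S) (Suc k) = top_edge t"
    using k t lower upper
    by (auto simp: e_def bottom_edge_def right_edge_def left_edge_def top_edge_def right_of_above)
  then show ?thesis
    using \<open>t \<in> set G\<close> lattice_path_tile_path[OF S] lattice_path_tile_path[OF T]
    unfolding covered_by_def split rest by auto
qed

section \<open>The isomorphism\<close>

text \<open>The count is the label of the tile \<open>t\<close>: the number of the two paths that pass above it.\<close>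

definition ideal_of :: "edge multiset \<Rightarrow> (tile \<times> nat) set" where
  "ideal_of M = {(t, j) \<in> PP_carrier G. j < count (image_mset snd M) (above t)}"

definition paths_of :: "(tile \<times> nat) set \<Rightarrow> edge multiset" where
  "paths_of I =
     path_edges (tile_path G {t. (t, 0) \<in> I}) + path_edges (tile_path G {t. (t, 1) \<in> I})"

lemma ideal_of_paths_of:
  assumes "I \<in> order_ideals (PP_carrier G) (PP_order G)"
  shows "ideal_of (paths_of I) = I"
proof -
  have I: "I \<subseteq> PP_carrier G" "\<And>t. (t, 1) \<in> I \<Longrightarrow> (t, 0) \<in> I"
    using assms unfolding PP_ideals_iff by auto
  have "(t, j) \<in> ideal_of (paths_of I) \<longleftrightarrow> (t, j) \<in> I" for t j
  proof (cases "(t, j) \<in> PP_carrier G")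
    case True
    then have "t \<in> set G" "j = 0 \<or> j = 1"
      by (auto simp: PP_carrier_def)
    then show ?thesis
      using I(2)[of t] True by (auto simp: ideal_of_def paths_of_def count_heads_tile_path)
  next
    case False
    then show ?thesis
      using I by (auto simp: ideal_of_def)
  qed
  then show ?thesis
    by auto
qed

lemma paths_of_in_double_lattice_paths:
  assumes "I \<in> order_ideals (PP_carrier G) (PP_order G)"
  shows "paths_of I \<in> double_lattice_paths G"
  using assms lattice_path_tile_path unfolding PP_ideals_iff double_lattice_paths_def paths_of_def
  by blast

text \<open>Uncrossing shows that nested pairs of ideals already give all double lattice paths.\<close>

lemma double_lattice_paths_eq:
  "double_lattice_paths G = paths_of ` order_ideals (PP_carrier G) (PP_order G)"
proof
  show "double_lattice_paths G \<subseteq> paths_of ` order_ideals (PP_carrier G) (PP_order G)"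
  proof
    fix M assume "M \<in> double_lattice_paths G"
    then obtain S T where S: "S \<in> order_ideals (set G) (tile_order G)"
      and T: "T \<in> order_ideals (set G) (tile_order G)"
      and M: "M = path_edges (tile_path G S) + path_edges (tile_path G T)"
      unfolding double_lattice_paths_def using lattice_path_imp_tile_path by (smt (verit) mem_Collect_eq)
    define I where "I = (S \<union> T) \<times> {0} \<union> (S \<inter> T) \<times> {1 :: nat}"
    have slices: "{t. (t, 0) \<in> I} = S \<union> T" "{t. (t, 1) \<in> I} = S \<inter> T"
      by (auto simp: I_def)
    have "I \<in> order_ideals (PP_carrier G) (PP_order G)"
      unfolding PP_ideals_iff slices using S T
      by (auto simp: I_def PP_carrier_def order_ideals_def)
    moreover have "M = paths_of I"
      unfolding paths_of_def slices M by (rule path_edges_sup_inf[OF S T])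
    ultimately show "M \<in> paths_of ` order_ideals (PP_carrier G) (PP_order G)"
      by blast
  qed
  show "paths_of ` order_ideals (PP_carrier G) (PP_order G) \<subseteq> double_lattice_paths G"
    using paths_of_in_double_lattice_paths by blast
qed

text \<open>Exchanging the edges of \<open>t\<close> replaces one edge ending in \<open>right_of t\<close> by one ending in
  \<open>above t\<close>.  No label decreases, because by levels \<open>right_of t\<close> is not of the form \<open>above s\<close> for
  any tile \<open>s\<close>.\<close>

lemma step_imp_ideal_of_subset:
  assumes "(M, M') \<in> double_lattice_path_step G"
  shows "ideal_of M \<subseteq> ideal_of M'"
proof -
  obtain p p' q where cover: "covered_by G p p'" and M: "M = path_edges p + path_edges q" "M' = path_edges p' + path_edges q"
    using assms unfolding double_lattice_path_step_def by blast
  obtain t where t: "t \<in> set G" "bottom_edge t \<in># path_edges p" "right_edge t \<in># path_edges p"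
    and p': "path_edges p' =
      path_edges p - {#bottom_edge t, right_edge t#} + {#left_edge t, top_edge t#}"
    using cover unfolding covered_by_def by blast
  have "bottom_edge t \<noteq> right_edge t"
    by (simp add: bottom_edge_def right_edge_def prod_eq_iff right_of_def)
  then have sub: "{#bottom_edge t, right_edge t#} \<subseteq># path_edges p"
    using t by (simp add: insert_subset_eq_iff in_diff_count)
  obtain R where R: "path_edges p = {#bottom_edge t, right_edge t#} + R"
    using sub by (metis subset_mset.add_diff_inverse)
  have "count (image_mset snd M) (above s) \<le> count (image_mset snd M') (above s)"
    if "s \<in> set G" for s
  proof -
    have "above s \<noteq> right_of t"
    proof
      assume *: "above s = right_of t"
      then have "level (above s) = level (right_of t)"
        by simp
      then have "s = t"
        using tile_eqI[OF that t(1)] by simp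
      then show False
        using * by simp
    qed
    then show ?thesis
      unfolding M p' R
      by (simp add: bottom_edge_def right_edge_def left_edge_def top_edge_def right_of_above)
  qed
  then show ?thesis
    by (fastforce simp: ideal_of_def PP_carrier_def)
qed

text \<open>The new element lies in one slice, whose path makes a covering move while the other path
  stays fixed.\<close>

lemma paths_of_insert_step:
  assumes I: "I \<in> order_ideals (PP_carrier G) (PP_order G)"
    and J: "insert x I \<in> order_ideals (PP_carrier G) (PP_order G)" and x: "x \<notin> I"
  shows "(paths_of I, paths_of (insert x I)) \<in> double_lattice_path_step G"
proof -
  define A where "A i = {t. (t, i) \<in> I}" for i :: nat
  obtain t j where tj: "x = (t, j)"
    by fastforce
  have A: "A 0 \<in> order_ideals (set G) (tile_order G)" "A 1 \<in> order_ideals (set G) (tile_order G)"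
    using I unfolding PP_ideals_iff A_def by auto
  have j: "j = 0 \<or> j = 1"
    using J tj unfolding PP_ideals_iff by (auto simp: PP_carrier_def)
  have slices: "{s. (s, i) \<in> insert x I} = (if i = j then insert t (A i) else A i)" for i
    by (auto simp: tj A_def)
  have B: "insert t (A j) \<in> order_ideals (set G) (tile_order G)"
    using J j unfolding PP_ideals_iff slices by auto
  have t: "t \<notin> A j"
    using x by (simp add: tj A_def)
  \<comment> \<open>the index of the slice that does not change\<close>
  define k where "k = 1 - j"
  have k: "A k \<in> order_ideals (set G) (tile_order G)" and j': "A j \<in> order_ideals (set G) (tile_order G)"
    using A j by (auto simp: k_def)
  have "paths_of I = path_edges (tile_path G (A j)) + path_edges (tile_path G (A k))"
    using j by (auto simp: paths_of_def k_def A_def)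
  moreover have "paths_of (insert x I) =
      path_edges (tile_path G (insert t (A j))) + path_edges (tile_path G (A k))"
    using j unfolding paths_of_def slices by (auto simp: k_def)
  ultimately show ?thesis
    unfolding double_lattice_path_step_def
    using covered_by_insert[OF j' B t] lattice_path_tile_path k j' B by blast
qed

lemma paths_of_mono_steps:
  assumes "I \<in> order_ideals (PP_carrier G) (PP_order G)"
    and J: "J \<in> order_ideals (PP_carrier G) (PP_order G)" and "I \<subseteq> J"
  shows "(paths_of I, paths_of J) \<in> (double_lattice_path_step G)\<^sup>*"
  using assms(1,3)
proof (induction "card (J - I)" arbitrary: I rule: less_induct)
  case less
  have fin: "finite (PP_carrier G)"
    by (simp add: PP_carrier_def)
  show ?case
  proof (cases "I = J")
    case False
    then obtain x where x: "x \<in> J - I" and xI: "insert x I \<in> order_ideals (PP_carrier G) (PP_order G)"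
      using ex_insert_order_ideal[OF partial_order_on_PP_order fin less.prems(1) J] less.prems(2)
      by blast
    have "finite (J - I)"
      using J fin by (auto simp: order_ideals_def intro: finite_subset)
    then have "card (J - insert x I) < card (J - I)"
      using x by (intro psubset_card_mono) auto
    then have "(paths_of (insert x I), paths_of J) \<in> (double_lattice_path_step G)\<^sup>*"
      using less.hyps xI x less.prems by auto
    moreover have "(paths_of I, paths_of (insert x I)) \<in> double_lattice_path_step G"
      using paths_of_insert_step less.prems(1) xI x by blast
    ultimately show ?thesis
      by simp
  qed simp
qed

lemma poset_iso_ideal_of:
  "poset_iso
     (double_lattice_paths G) (double_lattice_path_order G)
     (order_ideals (PP_carrier G) (PP_order G))
     (relation_of (\<subseteq>) (order_ideals (PP_carrier G) (PP_order G))) ideal_of"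
proof -
  let ?L = "double_lattice_paths G" and ?J = "order_ideals (PP_carrier G) (PP_order G)"
  let ?r = "double_lattice_path_order G"
  have bij: "bij_betw ideal_of ?L ?J"
    by (rule bij_betw_byWitness[where f' = paths_of])
      (auto simp: double_lattice_paths_eq ideal_of_paths_of)
  have mono: "ideal_of M \<subseteq> ideal_of M'" if "(M, M') \<in> (double_lattice_path_step G)\<^sup>*" for M M'
    using that by induction (use step_imp_ideal_of_subset in blast)+
  have order: "(M, M') \<in> ?r \<longleftrightarrow> ideal_of M \<subseteq> ideal_of M'" if M: "M \<in> ?L" "M' \<in> ?L" for M M'
  proof
    show "(M, M') \<in> ?r \<Longrightarrow> ideal_of M \<subseteq> ideal_of M'"
      using mono by (simp add: double_lattice_path_order_def)
    assume "ideal_of M \<subseteq> ideal_of M'"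
    then show "(M, M') \<in> ?r"
      using M paths_of_mono_steps unfolding double_lattice_path_order_def
      by (auto simp: double_lattice_paths_eq ideal_of_paths_of)
  qed
  have "antisym ?r"
  proof (rule antisymI)
    fix M M' assume *: "(M, M') \<in> ?r" "(M', M) \<in> ?r"
    then have L: "M \<in> ?L" "M' \<in> ?L"
      by (auto simp: double_lattice_path_order_def)
    then show "M = M'"
      using * order bij by (auto simp: bij_betw_def dest: inj_onD)
  qed
  moreover have "trans ?r"
    unfolding double_lattice_path_order_def by (intro trans_Restr trans_rtrancl)
  moreover have "refl_on ?L ?r" "?r \<subseteq> ?L \<times> ?L"
    by (auto simp: refl_on_def double_lattice_path_order_def)
  ultimately have "partial_order_on ?L ?r"
    by (simp add: partial_order_on_def preorder_on_def)
  moreover have "partial_order_on ?J (relation_of (\<subseteq>) ?J)"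
    by (rule partial_order_on_relation_ofI) auto
  moreover have "ideal_of M \<in> ?J" if "M \<in> ?L" for M
    using bij that by (auto simp: bij_betw_def)
  ultimately show ?thesis
    unfolding poset_iso_def using bij order by (auto simp: relation_of_def)
qed

end

theorem theorem9p1:
  fixes G :: "tile list"
  assumes "snake_graph G"
  shows "\<exists>f. poset_iso
           (double_lattice_paths G) (double_lattice_path_order G)
           (order_ideals (PP_carrier G) (PP_order G))
           (relation_of (\<subseteq>) (order_ideals (PP_carrier G) (PP_order G))) f"
  using poset_iso_ideal_of[OF assms] by blast

end
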